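(* Let $\Gamma_1=\mathrm{Cay}(\mathbb{Z}_3,\{2,1\})$, which is tight and has minimum distance diagram $\mathcal{H}_1=\mathrm{L}(2,2,1,1)$. Then for all integers $t\geq2$: (a) $\mathcal{H}_t=t\mathcal{H}_1=\mathrm{L}(2t,2t,t,t)$ is a tight minimum distance diagram of area $N_t=3t^2$; (b) $\mathcal{H}_t$ is a minimum distance diagram of $\Gamma_t=\mathrm{Cay}(\mathbb{Z}_t\oplus\mathbb{Z}_{3t},\{(1,-1),(0,1)\})$; (c) $\mathrm{D}(\Gamma_t)=\mathrm{D}_2(N_t)=\mathrm{lb}(N_t)=3t-2$.
   Context: A $2$--Cayley digraph is $\mathrm{Cay}(\mathrm{G},\{a,b\})$ with $\mathrm{G}$ a finite Abelian group and $a,b\in\mathrm{G}\setminus\{0\}$ generating it; vertices $\mathrm{G}$, arcs $g\to g+a$, $g\to g+b$; $\mathrm{D}(\cdot)$ denotes its diameter. For $N$ not square-free, $\mathrm{D}_2(N)$ is the minimum of $\mathrm{D}(\mathrm{G},A)$ over all non-cyclic Abelian groups $\mathrm{G}$ of order $N$ and generating sets $A\subset\mathrm{G}\setminus\{0\}$ of size two. $\mathrm{lb}(N)=\lceil\sqrt{3N}\rceil-2$; a $2$--Cayley digraph of order $N$ is tight if its diameter equals $\mathrm{lb}(N)$. A minimum distance diagram of $\mathrm{Cay}(\mathrm{G},\{a,b\})$ is a map $\psi:\mathrm{G}\to\mathbb{N}^2$ with $\psi(\eta)=(i,j)$, $ia+jb=\eta$, $i+j$ minimal, whose image is closed under coordinatewise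 smaller vectors in $\mathbb{N}^2$. For integers $0\le w<l$, $0\le y<h$, the L-shape $\mathrm{L}(l,h,w,y)=\{(i,j)\in\mathbb{Z}^2:0\le i<l,0\le j<h\}\setminus\{(i,j):l-w\le i<l,h-y\le j<h\}$ has area $lh-wy$ and diameter $l+h-\min\{w,y\}-2$; it is a minimum distance diagram of the digraph if it is the image of such a $\psi$, and it is tight if its diameter equals $\mathrm{lb}$ of its area. For an L-shape $\mathcal{H}=\mathrm{L}(l,h,w,y)$, $t\mathcal{H}=\mathrm{L}(tl,th,tw,ty)$. *)

theory Defs
  imports
    Complex_Main
    "HOL-Library.Extended_Real"
    "HOL-Library.Countable_Set"
    "HOL-Algebra.Elementary_Groups"
    "HOL-Algebra.Generated_Groups"
    "Graph_Theory.Shortest_Path"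
begin

definition cayley :: "('a, 'm) monoid_scheme \<Rightarrow> 'a set \<Rightarrow> ('a, 'a \<times> 'a) pre_digraph" where
  "cayley G A = \<lparr> verts = carrier G, arcs = {(g, g \<otimes>\<^bsub>G\<^esub> s) | g s. g \<in> carrier G \<and> s \<in> A},
                  tail = fst, head = snd \<rparr>"

definition diameter :: "('a, 'b) pre_digraph \<Rightarrow> ereal" where
  "diameter \<Gamma> = (SUP u\<in>verts \<Gamma>. SUP v\<in>verts \<Gamma>. wf_digraph.\<mu> \<Gamma> (\<lambda>_. 1) u v)"

definition two_cayley :: "('a, 'm) monoid_scheme \<Rightarrow> 'a set \<Rightarrow> bool" where
  "two_cayley G A \<longleftrightarrow> comm_group G \<and> finite (carrier G) \<and> A \<subseteq> carrier G - {\<one>\<^bsub>G\<^esub>}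
     \<and> card A = 2 \<and> generate G A = carrier G"

definition lb :: "nat \<Rightarrow> int" where
  "lb N = \<lceil>sqrt (3 * real N)\<rceil> - 2"

definition tight_cayley :: "('a, 'm) monoid_scheme \<Rightarrow> 'a set \<Rightarrow> bool" where
  "tight_cayley G A \<longleftrightarrow> two_cayley G A \<and> diameter (cayley G A) = ereal (real_of_int (lb (order G)))"

text \<open>Groups with carrier in \<^typ>\<open>nat\<close> represent all finite groups up to isomorphism; lemma
  \<open>D2_le\<close> below shows that the choice of this type does not matter. The distances are
  natural numbers or infinite, so the infimum over a nonempty set is a minimum; the set is
  empty for square-free \<open>N\<close>, giving infinity.\<close>

definition D2 :: "nat \<Rightarrow> ereal" where
  "D2 N = Inf {diameter (cayley G A) | (G :: nat monoid) A.
                 two_cayley G A \<and> order G = N \<and> \<not> cyclic_group G}"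

definition mdd_map :: "('a, 'm) monoid_scheme \<Rightarrow> 'a \<Rightarrow> 'a \<Rightarrow> ('a \<Rightarrow> nat \<times> nat) \<Rightarrow> bool" where
  "mdd_map G a b \<psi> \<longleftrightarrow>
     (\<forall>\<eta>\<in>carrier G. \<forall>i j. \<psi> \<eta> = (i, j) \<longrightarrow>
        a [^]\<^bsub>G\<^esub> i \<otimes>\<^bsub>G\<^esub> b [^]\<^bsub>G\<^esub> j = \<eta> \<and>
        (\<forall>i' j' :: nat. a [^]\<^bsub>G\<^esub> i' \<otimes>\<^bsub>G\<^esub> b [^]\<^bsub>G\<^esub> j' = \<eta> \<longrightarrow> i + j \<le> i' + j')) \<and>
     (\<forall>i j i' j'. (i, j) \<in> \<psi> ` carrier G \<longrightarrow> i' \<le> i \<longrightarrow> j' \<le> j \<longrightarrow> (i', j') \<in> \<psi> ` carrier G)"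

text \<open>An L-shape is kept as its parameters \<open>l\<close>, \<open>h\<close>, \<open>w\<close>, \<open>y\<close>, since
  dilation acts on these. Since \<open>w < l\<close> and \<open>y < h\<close> for a proper shape, no
  natural-number subtraction below truncates.\<close>

datatype lshape = L nat nat nat nat

fun is_lshape :: "lshape \<Rightarrow> bool" where
  "is_lshape (L l h w y) \<longleftrightarrow> w < l \<and> y < h"

fun cells :: "lshape \<Rightarrow> (nat \<times> nat) set" where
  "cells (L l h w y) = {(i, j). i < l \<and> j < h}
     - {(i, j). l - w \<le> i \<and> i < l \<and> h - y \<le> j \<and> j < h}"

fun lshape_area :: "lshape \<Rightarrow> nat" where
  "lshape_area (L l h w y) = l * h - w * y"

fun lshape_diameter :: "lshape \<Rightarrow> int" where
  "lshape_diameter (L l h w y) = int l + int h - int (min w y) - 2"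

fun dilate :: "nat \<Rightarrow> lshape \<Rightarrow> lshape" where
  "dilate t (L l h w y) = L (t * l) (t * h) (t * w) (t * y)"

definition tight_lshape :: "lshape \<Rightarrow> bool" where
  "tight_lshape H \<longleftrightarrow> is_lshape H \<and> lshape_diameter H = lb (lshape_area H)"

definition mdd_of :: "lshape \<Rightarrow> ('a, 'm) monoid_scheme \<Rightarrow> 'a \<Rightarrow> 'a \<Rightarrow> bool" where
  "mdd_of H G a b \<longleftrightarrow> is_lshape H \<and> two_cayley G {a, b} \<and>
     (\<exists>\<psi>. mdd_map G a b \<psi> \<and> \<psi> ` carrier G = cells H)"

text \<open>Being a minimum distance diagram of some digraph; as for \<^const>\<open>D2\<close>, the carrier type
  is no restriction (lemma \<open>is_mddI\<close>).\<close>

definition is_mdd :: "lshape \<Rightarrow> bool" where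
  "is_mdd H \<longleftrightarrow> (\<exists>(G :: nat monoid) a b. mdd_of H G a b)"

lemma card_cells:
  assumes "is_lshape H"
  shows "card (cells H) = lshape_area H"
proof (cases H)
  case (L l h w y)
  have eq: "cells H = {..<l} \<times> {..<h} - {l - w..<l} \<times> {h - y..<h}"
    by (auto simp: L)
  have "card (cells H) = card ({..<l} \<times> {..<h}) - card ({l - w..<l} \<times> {h - y..<h})"
    unfolding eq by (rule card_Diff_subset) auto
  also have "\<dots> = lshape_area H"
    using assms by (simp add: L)
  finally show ?thesis .
qed

lemma Max_cells:
  assumes "is_lshape H"
  shows "int (Max ((\<lambda>(i, j). i + j) ` cells H)) = lshape_diameter H"
proof (cases H)
  case (L l h w y)
  have lt: "w < l" "y < h" using assms by (auto simp: L)
  define m where "m = l + h - min w y - 2"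
  have fin: "finite (cells H)"
    by (rule finite_subset[of _ "{..<l} \<times> {..<h}"]) (auto simp: L)
  have "Max ((\<lambda>(i, j). i + j) ` cells H) = m"
  proof (rule Max_eqI)
    show "k \<le> m" if "k \<in> (\<lambda>(i, j). i + j) ` cells H" for k
      using that lt by (auto simp: L m_def min_def)
    show "m \<in> (\<lambda>(i, j). i + j) ` cells H"
    proof (cases "w \<le> y")
      case True
      have "(l - w - 1, h - 1) \<in> cells H" using lt by (auto simp: L)
      moreover have "m = (l - w - 1) + (h - 1)" using True lt by (simp add: m_def)
      ultimately show ?thesis by force
    next
      case False
      have "(l - 1, h - y - 1) \<in> cells H" using lt by (auto simp: L)
      moreover have "m = (l - 1) + (h - y - 1)" using False lt by (simp add: m_def)
      ultimately show ?thesis by force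
    qed
  qed (use fin in simp)
  moreover have "int m = lshape_diameter H" using lt by (simp add: L m_def)
  ultimately show ?thesis by simp
qed

lemma nat_copy:
  fixes G :: "'a monoid"
  assumes "comm_group G" "finite (carrier G)"
  obtains f :: "'a \<Rightarrow> nat" and H :: "nat monoid" where "comm_group H" "f \<in> iso G H"
proof -
  interpret G: comm_group G by fact
  obtain f :: "'a \<Rightarrow> nat" where f: "inj_on f (carrier G)"
    using assms(2) by (metis countable_finite countable_def)
  define g where "g = inv_into (carrier G) f"
  have gf [simp]: "g (f x) = x" if "x \<in> carrier G" for x
    using that f by (simp add: g_def)
  define H :: "nat monoid" where
    "H = \<lparr> carrier = f ` carrier G, monoid.mult = (\<lambda>x y. f (g x \<otimes>\<^bsub>G\<^esub> g y)), one = f \<one>\<^bsub>G\<^esub> \<rparr>"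
  have "comm_group H"
  proof (rule comm_groupI)
    fix x assume "x \<in> carrier H"
    then obtain u where u: "u \<in> carrier G" "x = f u" by (auto simp: H_def)
    show "\<exists>y\<in>carrier H. y \<otimes>\<^bsub>H\<^esub> x = \<one>\<^bsub>H\<^esub>"
      using u by (intro bexI[of _ "f (inv\<^bsub>G\<^esub> u)"]) (auto simp: H_def)
  next
    fix x y assume "x \<in> carrier H" "y \<in> carrier H"
    then show "x \<otimes>\<^bsub>H\<^esub> y = y \<otimes>\<^bsub>H\<^esub> x" by (auto simp: H_def G.m_comm)
  qed (auto simp: H_def G.m_assoc)
  moreover have "f \<in> iso G H"
    using f by (auto simp: iso_def hom_def bij_betw_def H_def)
  ultimately show thesis by (rule that)
qed

lemma iso_two_cayley:
  fixes G :: "'a monoid" and H :: "'b monoid"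
  assumes "two_cayley G A" "comm_group H" "f \<in> iso G H"
  shows "two_cayley H (f ` A)"
proof -
  interpret G: comm_group G using assms by (simp add: two_cayley_def)
  interpret H: comm_group H by fact
  interpret f: group_hom G H f
    using assms(3) by unfold_locales (auto simp: iso_def)
  have A: "A \<subseteq> carrier G" "\<one>\<^bsub>G\<^esub> \<notin> A" "card A = 2" "generate G A = carrier G"
    and fin: "finite (carrier G)"
    using assms(1) by (auto simp: two_cayley_def)
  have inj: "inj_on f (carrier G)" and im: "f ` carrier G = carrier H"
    using assms(3) by (auto simp: iso_def bij_betw_def)
  have "\<one>\<^bsub>H\<^esub> \<notin> f ` A"
    using A inj by (metis f.hom_one G.one_closed inj_on_image_mem_iff)
  moreover have "card (f ` A) = 2"
    using A inj by (metis card_image inj_on_subset)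
  moreover have "generate H (f ` A) = carrier H"
    using f.generate_img[OF A(1)] A(4) im by simp
  moreover have "finite (carrier H)" using fin im by (metis finite_imageI)
  ultimately show ?thesis
    using image_mono[OF A(1), of f] im assms(2) unfolding two_cayley_def by blast
qed

lemma iso_diameter_le:
  fixes G :: "'a monoid" and H :: "'b monoid"
  assumes "two_cayley G A" "comm_group H" "f \<in> iso G H"
  shows "diameter (cayley H (f ` A)) \<le> diameter (cayley G A)"
proof -
  interpret G: comm_group G using assms by (simp add: two_cayley_def)
  interpret H: comm_group H by fact
  have A: "A \<subseteq> carrier G" using assms by (auto simp: two_cayley_def)
  have hom: "f \<in> hom G H" and im: "carrier H = f ` carrier G"
    using assms(3) by (auto simp: iso_def bij_betw_def)
  have fcl: "f x \<in> carrier H" if "x \<in> carrier G" for x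
    using that im by simp
  interpret CG: wf_digraph "cayley G A"
    by unfold_locales (use A in \<open>auto simp: cayley_def\<close>)
  interpret CH: wf_digraph "cayley H (f ` A)"
    by unfold_locales (use A fcl in \<open>auto simp: cayley_def intro!: H.m_closed\<close>)
  have walk: "CH.awalk (f u) (map (map_prod f f) p) (f v)" if "CG.awalk u p v" for u p v
    using that
  proof (induction p arbitrary: u)
    case Nil
    then have "u = v" "u \<in> carrier G"
      by (simp_all add: CG.awalk_Nil_iff) (auto simp: cayley_def)
    then have "f u = f v" "f v \<in> verts (cayley H (f ` A))"
      using fcl by (simp_all add: cayley_def)
    then show ?case by (simp add: CH.awalk_Nil_iff)
  next
    case (Cons e p)
    then have e: "e \<in> arcs (cayley G A)" "tail (cayley G A) e = u"
      and p: "CG.awalk (head (cayley G A) e) p v"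
      by (auto simp: CG.awalk_Cons_iff)
    then obtain s where s: "u \<in> carrier G" "s \<in> A" "e = (u, u \<otimes>\<^bsub>G\<^esub> s)"
      by (auto simp: cayley_def)
    have "f (u \<otimes>\<^bsub>G\<^esub> s) = f u \<otimes>\<^bsub>H\<^esub> f s"
      using hom s A by (auto simp: hom_def)
    with s im have "map_prod f f e \<in> arcs (cayley H (f ` A))"
      by (auto simp: cayley_def)
    moreover have "CH.awalk (f (u \<otimes>\<^bsub>G\<^esub> s)) (map (map_prod f f) p) (f v)"
      using Cons.IH[OF p] s by (simp add: cayley_def)
    ultimately show ?case
      using s by (simp add: CH.awalk_Cons_iff) (simp add: cayley_def)
  qed
  have cost: "CH.awalk_cost (\<lambda>_. 1) (map (map_prod f f) p) = CG.awalk_cost (\<lambda>_. 1) p" for p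
    by (simp add: CH.awalk_cost_def CG.awalk_cost_def comp_def)
  have mu: "CH.\<mu> (\<lambda>_. 1) (f u) (f v) \<le> CG.\<mu> (\<lambda>_. 1) u v" for u v
    unfolding CG.\<mu>_def
  proof (rule INF_greatest)
    fix p assume "p \<in> {p. CG.awalk u p v}"
    then show "CH.\<mu> (\<lambda>_. 1) (f u) (f v) \<le> ereal (CG.awalk_cost (\<lambda>_. 1) p)"
      using CH.min_cost_le_walk_cost[OF walk] cost by (metis mem_Collect_eq)
  qed
  have "CH.\<mu> (\<lambda>_. 1) u' v' \<le> diameter (cayley G A)"
    if uv': "u' \<in> carrier H" "v' \<in> carrier H" for u' v'
  proof -
    obtain u v where uv: "u \<in> carrier G" "v \<in> carrier G" "u' = f u" "v' = f v"
      using uv' im by auto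
    have "CG.\<mu> (\<lambda>_. 1) u v \<le> diameter (cayley G A)"
      unfolding diameter_def
      by (rule SUP_upper2[of u], use uv in \<open>simp add: cayley_def\<close>)
         (rule SUP_upper, use uv in \<open>simp add: cayley_def\<close>)
    then show ?thesis using mu[of u v] uv by simp
  qed
  then show ?thesis
    by (subst (1) diameter_def, intro SUP_least) (simp_all add: cayley_def)
qed

lemma D2_le:
  fixes G :: "'a monoid"
  assumes "two_cayley G A" "order G = N" "\<not> cyclic_group G"
  shows "D2 N \<le> diameter (cayley G A)"
proof -
  have G: "comm_group G" "finite (carrier G)" using assms(1) by (auto simp: two_cayley_def)
  then obtain f :: "'a \<Rightarrow> nat" and H :: "nat monoid" where H: "comm_group H" "f \<in> iso G H"
    by (rule nat_copy)
  have "order H = N"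
    using H(2) assms(2) by (auto simp: order_def iso_def dest: bij_betw_same_card)
  moreover have "\<not> cyclic_group H"
    using isomorphic_group_cyclicity[of G H] H G assms(3)
    by (auto simp: is_iso_def comm_group_def)
  ultimately have "D2 N \<le> diameter (cayley H (f ` A))"
    unfolding D2_def using iso_two_cayley[OF assms(1) H] by (intro Inf_lower) blast
  also have "\<dots> \<le> diameter (cayley G A)"
    by (rule iso_diameter_le[OF assms(1) H])
  finally show ?thesis .
qed

lemma is_mddI:
  fixes G :: "'a monoid"
  assumes "mdd_of S G a b"
  shows "is_mdd S"
proof -
  have S: "is_lshape S" and tc: "two_cayley G {a, b}" using assms by (auto simp: mdd_of_def)
  obtain \<psi> where \<psi>: "mdd_map G a b \<psi>" "\<psi> ` carrier G = cells S"
    using assms by (auto simp: mdd_of_def)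
  have G: "comm_group G" "finite (carrier G)" and ab: "a \<in> carrier G" "b \<in> carrier G"
    using tc by (auto simp: two_cayley_def)
  obtain f :: "'a \<Rightarrow> nat" and H :: "nat monoid" where H: "comm_group H" "f \<in> iso G H"
    using G by (rule nat_copy)
  interpret G: comm_group G by fact
  interpret H: comm_group H by fact
  interpret f: group_hom G H f
    using H(2) by unfold_locales (auto simp: iso_def)
  have inj: "inj_on f (carrier G)" and im: "carrier H = f ` carrier G"
    using H(2) by (auto simp: iso_def bij_betw_def)
  define \<phi> where "\<phi> = \<psi> \<circ> inv_into (carrier G) f"
  have \<phi>: "\<phi> (f x) = \<psi> x" if "x \<in> carrier G" for x
    using that inj by (simp add: \<phi>_def)
  then have img: "\<phi> ` carrier H = \<psi> ` carrier G"
    by (auto simp: im image_image)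
  have pow: "f a [^]\<^bsub>H\<^esub> i \<otimes>\<^bsub>H\<^esub> f b [^]\<^bsub>H\<^esub> j = f x \<longleftrightarrow> a [^]\<^bsub>G\<^esub> i \<otimes>\<^bsub>G\<^esub> b [^]\<^bsub>G\<^esub> j = x"
    if "x \<in> carrier G" for x and i j :: nat
  proof -
    have "f a [^]\<^bsub>H\<^esub> i \<otimes>\<^bsub>H\<^esub> f b [^]\<^bsub>H\<^esub> j = f (a [^]\<^bsub>G\<^esub> i \<otimes>\<^bsub>G\<^esub> b [^]\<^bsub>G\<^esub> j)"
      using ab by (simp add: f.hom_nat_pow)
    moreover have "a [^]\<^bsub>G\<^esub> i \<otimes>\<^bsub>G\<^esub> b [^]\<^bsub>G\<^esub> j \<in> carrier G" using ab by simp
    ultimately show ?thesis using that inj_on_eq_iff[OF inj] by metis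
  qed
  have "mdd_map H (f a) (f b) \<phi>"
    using \<psi>(1) unfolding mdd_map_def img by (simp add: im \<phi> pow)
  moreover have "two_cayley H {f a, f b}"
    using iso_two_cayley[OF tc H] by simp
  ultimately have "mdd_of S H (f a) (f b)"
    using S img \<psi>(2) by (auto simp: mdd_of_def)
  then show ?thesis unfolding is_mdd_def by blast
qed

end

theory Submission
  imports Defs "HOL-Algebra.Multiplicative_Group"
begin

text \<open>For the lower bound, choose for every group element its least representation as
  \<open>ia + jb\<close>. These pairs form a down-closed set \<open>S\<close> that meets every class of \<open>\<nat>\<^sup>2\<close>
  modulo the relations of \<open>a\<close> and \<open>b\<close> exactly once. Every minimal pair outside \<open>S\<close> with two
  positive coordinates represents \<open>0\<close>, and two such pairs would make two distinct elements of \<open>S\<close> on the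
  axes congruent; hence there is at most one, and \<open>S\<close> is an L-shape. The diameter of an
  L-shape of area \<open>N\<close> is at least \<open>lb N\<close> since
  \<open>(l + h - m)\<^sup>2 - 3(lh - m\<^sup>2) = ((l + h)/2 - 2m)\<^sup>2 + 3(l - h)\<^sup>2/4\<close>, where \<open>m = min w y\<close>.

  For the digraphs of the theorem, two pairs represent the same element iff their difference
  is \<open>t(p, q)\<close> with \<open>p \<equiv> q\<close> modulo 3. Starting from a cell of \<open>L(2t, 2t, t, t)\<close> and ending
  in \<open>\<nat>\<^sup>2\<close> forces \<open>p, q \<ge> -1\<close>, not both equal to \<open>-1\<close>, so \<open>p + q \<ge> 0\<close>.\<close>

section \<open>Tiles of the quarter plane\<close>

text \<open>Stated for an abstract labelling \<open>f\<close>, later the value of ia + jb: the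
  argument is pure combinatorics of a transversal under cancellation of a common vector.\<close>

lemma downset_tile_is_lshape:
  fixes S :: "(nat \<times> nat) set" and f :: "nat \<Rightarrow> nat \<Rightarrow> 'a"
  assumes "finite S"
    and inj: "inj_on (\<lambda>(i, j). f i j) S"
    and down: "\<And>i j i' j'. (i, j) \<in> S \<Longrightarrow> i' \<le> i \<Longrightarrow> j' \<le> j \<Longrightarrow> (i', j') \<in> S"
    and cover: "\<And>i j. \<exists>i' j'. (i', j') \<in> S \<and> f i' j' = f i j"
    and cancel: "\<And>i j i' j' k m. f (i + k) (j + m) = f (i' + k) (j' + m) \<Longrightarrow> f i j = f i' j'"
  obtains H where "is_lshape H" "S = cells H"
proof -
  have inj': "i = i' \<and> j = j'" if "(i, j) \<in> S" "(i', j') \<in> S" "f i j = f i' j'" for i j i' j'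
    using inj_onD[OF inj, of "(i, j)" "(i', j')"] that by simp
  have zero: "(0, 0) \<in> S" using cover[of 0 0] down by blast
  have initial: "\<exists>l. \<forall>n. g n \<in> S \<longleftrightarrow> n < l"
    if "inj g" "\<And>m n. g n \<in> S \<Longrightarrow> m \<le> n \<Longrightarrow> g m \<in> S" for g :: "nat \<Rightarrow> nat \<times> nat"
  proof -
    have "finite (g -` S)" using \<open>finite S\<close> that(1) by (rule finite_vimageI)
    then have "\<exists>n. n \<notin> g -` S" using ex_new_if_finite infinite_UNIV_nat by metis
    then have "\<exists>n. g n \<notin> S" by simp
    define l where "l = (LEAST n. g n \<notin> S)"
    have "g l \<notin> S" unfolding l_def using \<open>\<exists>n. g n \<notin> S\<close> by (rule LeastI_ex)
    moreover have "g n \<in> S" if "n < l" for n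
      using not_less_Least[of n "\<lambda>n. g n \<notin> S"] that by (simp add: l_def)
    ultimately show ?thesis using that(2) by (metis not_less)
  qed
  obtain l where l: "\<And>n. (n, 0) \<in> S \<longleftrightarrow> n < l"
    using initial[of "\<lambda>n. (n, 0)"] down by (auto simp: inj_def)
  obtain h where h: "\<And>n. (0, n) \<in> S \<longleftrightarrow> n < h"
    using initial[of "\<lambda>n. (0, n)"] down by (auto simp: inj_def)
  have lh: "i < l \<and> j < h" if "(i, j) \<in> S" for i j
    using down[OF that, of i 0] down[OF that, of 0 j] l h by simp
  \<comment> \<open>These are the minimal pairs outside \<open>S\<close> off the axes: by
    down-closure it suffices to look at the two lower neighbours. Positivity keeps
    \<open>x - 1\<close> and \<open>y - 1\<close> from truncating.\<close>
  define corner where "corner = (\<lambda>x y. (x, y) \<notin> S \<and> 0 < x \<and> 0 < y \<and> (x - 1, y) \<in> S \<and> (x, y - 1) \<in> S)"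
  have corner_ex: "\<exists>x y. corner x y \<and> x \<le> i \<and> y \<le> j" if "i < l" "j < h" "(i, j) \<notin> S" for i j
  proof -
    \<comment> \<open>Move left along row \<open>j\<close> to its first gap, then down column
      \<open>x\<close> to its first gap; the left neighbour of the result stays in \<open>S\<close>
      by down-closure.\<close>
    define x where "x = (LEAST x. (x, j) \<notin> S)"
    have x: "(x, j) \<notin> S" "x \<le> i" unfolding x_def
      using that(3) by (rule LeastI Least_le)+
    have x0: "0 < x" using x(1) h that(2) by (cases x) auto
    have x1: "(x - 1, j) \<in> S"
      using not_less_Least[of "x - 1" "\<lambda>x. (x, j) \<notin> S"] x0 by (simp add: x_def)
    define y where "y = (LEAST y. (x, y) \<notin> S)"
    have y: "(x, y) \<notin> S" "y \<le> j" unfolding y_def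
      using x(1) by (rule LeastI Least_le)+
    have y0: "0 < y" using y(1) l x(2) that(1) by (cases y) auto
    have "(x, y - 1) \<in> S"
      using not_less_Least[of "y - 1" "\<lambda>y. (x, y) \<notin> S"] y0 by (simp add: y_def)
    with x y x0 y0 down[OF x1, of "x - 1" y] show ?thesis
      unfolding corner_def by blast
  qed
  \<comment> \<open>A representative of a corner \<open>(x, y)\<close> with a positive coordinate could be shifted, together
    with \<open>(x, y)\<close>, to a collision inside \<open>S\<close>.\<close>
  have corner_zero: "f x y = f 0 0" if c: "corner x y" for x y
  proof -
    obtain u v where uv: "(u, v) \<in> S" "f u v = f x y" using cover by blast
    have "u = 0"
    proof (rule ccontr)
      assume "u \<noteq> 0"
      then have "f (u - 1) v = f (x - 1) y"
        using cancel[of "u - 1" 1 v 0 "x - 1" y] uv(2) c by (simp add: corner_def)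
      then have "u - 1 = x - 1" "v = y"
        using inj'[of "u - 1" v "x - 1" y] c down[OF uv(1), of "u - 1" v] by (auto simp: corner_def)
      then have "(u, v) = (x, y)" using c \<open>u \<noteq> 0\<close> by (auto simp: corner_def)
      then show False using uv(1) c by (simp add: corner_def)
    qed
    moreover have "v = 0"
    proof (rule ccontr)
      assume "v \<noteq> 0"
      then have "f u (v - 1) = f x (y - 1)"
        using cancel[of u 0 "v - 1" 1 x "y - 1"] uv(2) c by (simp add: corner_def)
      then have "u = x" "v - 1 = y - 1"
        using inj'[of u "v - 1" x "y - 1"] c down[OF uv(1), of u "v - 1"] by (auto simp: corner_def)
      then have "(u, v) = (x, y)" using c \<open>v \<noteq> 0\<close> by (auto simp: corner_def)
      then show False using uv(1) c by (simp add: corner_def)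
    qed
    ultimately show ?thesis using uv(2) by simp
  qed
  have corner_le: "x = x' \<and> y = y'" if c: "corner x y" "corner x' y'" and "x \<le> x'" for x y x' y'
  proof (cases "y \<le> y'")
    case True
    \<comment> \<open>Otherwise \<open>(x, y)\<close> would lie below a neighbour of
      \<open>(x', y')\<close> that belongs to \<open>S\<close>.\<close>
    have "\<not> x \<le> x' - 1" "\<not> y \<le> y' - 1"
      using c True \<open>x \<le> x'\<close> down[of "x' - 1" y' x y] down[of x' "y' - 1" x y]
      by (auto simp: corner_def)
    then show ?thesis using True \<open>x \<le> x'\<close> by presburger
  next
    case False
    \<comment> \<open>Both corners represent 0. Cancelling their common part \<open>(x, y')\<close>
      leaves congruent points on the two axes, both in \<open>S\<close>, so injectivity sends both
      to the origin.\<close>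
    have "f (x' - x + x) (0 + y') = f (0 + x) (y - y' + y')"
      using corner_zero[OF c(1)] corner_zero[OF c(2)] \<open>x \<le> x'\<close> False by simp
    then have "f (x' - x) 0 = f 0 (y - y')" by (rule cancel)
    moreover have "(x' - x, 0) \<in> S" "(0, y - y') \<in> S"
      using c down[of "x' - 1" y' "x' - x" 0] down[of x "y - 1" 0 "y - y'"]
      by (auto simp: corner_def)
    ultimately have "0 = y - y'" using inj' by blast
    with False show ?thesis by simp
  qed
  have pos: "0 < l" "0 < h" using zero l h by auto
  show thesis
  proof (cases "\<exists>x y. corner x y")
    case False
    \<comment> \<open>Without a corner the whole box is filled: the notch is empty.\<close>
    with corner_ex lh have "S = cells (L l h 0 0)" by auto
    with pos show thesis by (intro that[of "L l h 0 0"]) auto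
  next
    case True
    then obtain x y where c: "corner x y" by blast
    have uniq: "x' = x \<and> y' = y" if "corner x' y'" for x' y'
      using corner_le[OF c that] corner_le[OF that c] by (cases "x \<le> x'") auto
    have xy: "0 < x" "x \<le> l" "0 < y" "y \<le> h"
      using c lh[of "x - 1" y] lh[of x "y - 1"] by (auto simp: corner_def)
    have "(i, j) \<in> S \<longleftrightarrow> i < l \<and> j < h \<and> \<not> (x \<le> i \<and> y \<le> j)" for i j
      using lh corner_ex uniq down[of i j x y] c unfolding corner_def by metis
    \<comment> \<open>The notch starts at the corner and extends to the far sides of the box;
      positive corner coordinates make the L-shape proper.\<close>
    then have "S = cells (L l h (l - x) (h - y))"
      using xy by auto
    with xy pos show thesis by (intro that[of "L l h (l - x) (h - y)"]) auto
  qed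
qed

lemma lb_le_lshape_diameter:
  assumes "is_lshape H"
  shows "lb (lshape_area H) \<le> lshape_diameter H"
proof (cases H)
  case (L l h w y)
  have wy: "w < l" "y < h" using assms by (auto simp: L)
  \<comment> \<open>The diameter depends on \<open>w\<close> and \<open>y\<close> through
    \<open>m\<close> alone, while the area is at most lh - m^2. This reduces the bound to a square
    notch.\<close>
  define m where "m = min w y"
  have "m * m \<le> w * y" by (simp add: m_def mult_le_mono)
  then have mm: "real m * real m \<le> real w * real y"
    by (metis of_nat_le_iff of_nat_mult)
  have le: "w * y \<le> l * h" using wy by (simp add: mult_le_mono)
  define d where "d = lshape_diameter H + 2"
  have d: "real_of_int d = real l + real h - real m" by (simp add: d_def L m_def)
  have "0 \<le> real_of_int d" using wy by (simp add: d m_def)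
  have "3 * real (lshape_area H) = 3 * (real l * real h - real w * real y)"
    using le by (simp add: L of_nat_diff)
  also have "\<dots> \<le> 3 * (real l * real h - real m * real m)" using mm by simp
  also have "\<dots> \<le> (real_of_int d)\<^sup>2"
  proof -
    have "(real_of_int d)\<^sup>2 - 3 * (real l * real h - real m * real m)
        = ((real l + real h) / 2 - 2 * real m)\<^sup>2 + 3 / 4 * (real l - real h)\<^sup>2"
      unfolding d by (simp add: power2_eq_square field_simps)
    also have "\<dots> \<ge> 0" by simp
    finally show ?thesis by simp
  qed
  finally have "sqrt (3 * real (lshape_area H)) \<le> real_of_int d"
    by (rule real_le_lsqrt[OF \<open>0 \<le> real_of_int d\<close>])
  \<comment> \<open>Rounding up costs nothing because \<open>d\<close> is an integer.\<close>
  then have "\<lceil>sqrt (3 * real (lshape_area H))\<rceil> \<le> d" by (simp only: ceiling_le_iff)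
  then show ?thesis by (simp add: lb_def d_def)
qed

section \<open>Distances in Cayley digraphs\<close>

lemma wf_digraph_cayley:
  assumes "group G" "A \<subseteq> carrier G"
  shows "wf_digraph (cayley G A)"
proof -
  interpret group G by fact
  show ?thesis by unfold_locales (use assms(2) in \<open>auto simp: cayley_def\<close>)
qed

context comm_group
begin

text \<open>Supplies the cancellation hypothesis of \<open>downset_tile_is_lshape\<close>.\<close>

lemma pow_mult_pow_cancel:
  fixes i j i' j' k m :: nat
  assumes "a \<in> carrier G" "b \<in> carrier G"
  shows "a [^] (i + k) \<otimes> b [^] (j + m) = a [^] (i' + k) \<otimes> b [^] (j' + m)
    \<longleftrightarrow> a [^] i \<otimes> b [^] j = a [^] i' \<otimes> b [^] j'"
proof -
  have split: "a [^] (p + k) \<otimes> b [^] (q + m) = (a [^] p \<otimes> b [^] q) \<otimes> (a [^] k \<otimes> b [^] m)"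
    for p q :: nat
    using assms by (simp add: nat_pow_mult[symmetric] m_ac)
  show ?thesis unfolding split using assms by (simp add: right_cancel)
qed

text \<open>In a finite group the inverse of \<open>z\<close> is its power with exponent
  \<open>order G - 1\<close>, so nonnegative exponents reach the whole generated subgroup.\<close>

lemma generate_pair:
  assumes "finite (carrier G)" "a \<in> carrier G" "b \<in> carrier G" "x \<in> generate G {a, b}"
  shows "\<exists>(i :: nat) (j :: nat). a [^] i \<otimes> b [^] j = x"
  using assms(4)
proof induction
  case one
  show ?case by (intro exI[of _ 0]) simp
next
  case (incl c)
  then show ?case
    using assms(2,3)
    by (auto intro: exI[of _ "1 :: nat"] exI[of _ "0 :: nat"])
       (metis nat_pow_0 nat_pow_eone r_one l_one)+
next
  case (inv c)
  have inv_pow: "inv z = z [^] (order G - 1)" if "z \<in> carrier G" for z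
  proof -
    have "0 < order G" using order_gt_0_iff_finite assms(1) by blast
    then have "z [^] (order G - 1) \<otimes> z = z [^] order G"
      by (metis Suc_pred' nat_pow_Suc)
    then show ?thesis using that pow_order_eq_1[OF that] by (metis inv_equality nat_pow_closed)
  qed
  have "a [^] (order G - 1) \<otimes> b [^] (0 :: nat) = inv a" "a [^] (0 :: nat) \<otimes> b [^] (order G - 1) = inv b"
    using assms(2,3) by (simp_all add: inv_pow)
  with inv show ?case by blast
next
  case (eng x y)
  then obtain i j i' j' :: nat where
    "a [^] i \<otimes> b [^] j = x" "a [^] i' \<otimes> b [^] j' = y" by blast
  then have "a [^] (i + i') \<otimes> b [^] (j + j') = x \<otimes> y"
    using assms(2,3) by (auto simp: nat_pow_mult[symmetric] m_ac)
  then show ?case by blast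
qed

text \<open>By commutativity the endpoint depends only on how many arcs of each kind are used, which
  turns distances into questions about exponent pairs.\<close>

lemma awalk_cayley_imp_pow:
  assumes "a \<in> carrier G" "b \<in> carrier G" "pre_digraph.awalk (cayley G {a, b}) u p v"
  shows "\<exists>i j. length p = i + j \<and> v = u \<otimes> (a [^] i \<otimes> b [^] j)"
proof -
  interpret C: wf_digraph "cayley G {a, b}"
    by (rule wf_digraph_cayley) (use assms in auto)
  show ?thesis using assms(3)
  proof (induction p arbitrary: u)
    case Nil
    then have "u = v \<and> u \<in> verts (cayley G {a, b})" by (auto simp: C.awalk_Nil_iff)
    then have "u = v" "u \<in> carrier G" by (auto simp: cayley_def)
    then show ?case by (intro exI[of _ 0]) simp
  next
    case (Cons e p)
    then have e: "e \<in> arcs (cayley G {a, b})" "u = tail (cayley G {a, b}) e"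
      and p: "C.awalk (head (cayley G {a, b}) e) p v"
      by (simp_all add: C.awalk_Cons_iff)
    obtain g s where gs: "e = (g, g \<otimes> s)" "g \<in> carrier G" "s \<in> {a, b}"
      using e(1) unfolding cayley_def by (simp only: pre_digraph.simps mem_Collect_eq) blast
    then have s: "u \<in> carrier G" "s \<in> {a, b}" "head (cayley G {a, b}) e = u \<otimes> s"
      using e(2) by (simp_all add: cayley_def)
    obtain i j where ij: "length p = i + j" "v = u \<otimes> s \<otimes> (a [^] i \<otimes> b [^] j)"
      using Cons.IH[OF p] s(3) by auto
    from s(2) consider "s = a" | "s = b" by blast
    then show ?case
    proof cases
      case 1
      then show ?thesis using ij s(1) assms(1,2)
        by (intro exI[of _ "Suc i"] exI[of _ j]) (simp add: m_ac)
    next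
      case 2
      then show ?thesis using ij s(1) assms(1,2)
        by (intro exI[of _ i] exI[of _ "Suc j"]) (simp add: m_ac)
    qed
  qed
qed

text \<open>The walk takes all \<open>a\<close>-arcs first and then all
  \<open>b\<close>-arcs.\<close>

lemma pow_imp_awalk_cayley:
  assumes "a \<in> carrier G" "b \<in> carrier G" "u \<in> carrier G"
  shows "\<exists>p. pre_digraph.awalk (cayley G {a, b}) u p (u \<otimes> (a [^] i \<otimes> b [^] j)) \<and> length p = i + j"
proof -
  interpret C: wf_digraph "cayley G {a, b}"
    by (rule wf_digraph_cayley) (use assms in auto)
  have step: "\<exists>p. C.awalk u p v \<and> length p = Suc n"
    if ex: "\<exists>p. C.awalk (u \<otimes> s) p v \<and> length p = n" and s: "s \<in> {a, b}" "u \<in> carrier G" for u s v n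
  proof -
    obtain p where "C.awalk (u \<otimes> s) p v" "length p = n" using ex by blast
    then have "C.awalk u ((u, u \<otimes> s) # p) v"
      using s by (auto simp: C.awalk_Cons_iff) (auto simp: cayley_def)
    with \<open>length p = n\<close> show ?thesis by (intro exI[of _ "(u, u \<otimes> s) # p"]) simp
  qed
  have b_walk: "\<exists>p. C.awalk u p (u \<otimes> b [^] j) \<and> length p = j" if "u \<in> carrier G" for u
    using that
  proof (induction j arbitrary: u)
    case 0
    then show ?case by (auto simp: C.awalk_Nil_iff) (simp add: cayley_def)
  next
    case (Suc j)
    have "u \<otimes> b [^] Suc j = (u \<otimes> b) \<otimes> b [^] j"
      using Suc.prems assms(2) by (simp add: m_ac)
    with step[OF Suc.IH[of "u \<otimes> b"]] Suc.prems assms(2) show ?case by simp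
  qed
  show ?thesis using assms(3)
  proof (induction i arbitrary: u)
    case 0
    then show ?case using b_walk[of u] assms(2) by simp
  next
    case (Suc i)
    have "u \<otimes> (a [^] Suc i \<otimes> b [^] j) = (u \<otimes> a) \<otimes> (a [^] i \<otimes> b [^] j)"
      using Suc.prems assms(1,2) by (simp add: m_ac)
    with step[OF Suc.IH[of "u \<otimes> a"]] Suc.prems assms(1) show ?case by simp
  qed
qed

lemma diameter_cayley_le:
  assumes ab: "a \<in> carrier G" "b \<in> carrier G"
    and cover: "\<And>x. x \<in> carrier G \<Longrightarrow> \<exists>i j. a [^] i \<otimes> b [^] j = x \<and> i + j \<le> n"
  shows "diameter (cayley G {a, b}) \<le> ereal (real n)"
proof -
  interpret C: wf_digraph "cayley G {a, b}"
    by (rule wf_digraph_cayley) (use ab in auto)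
  have "C.\<mu> (\<lambda>_. 1) u v \<le> ereal (real n)" if uv: "u \<in> carrier G" "v \<in> carrier G" for u v
  proof -
    \<comment> \<open>Translations are automorphisms: going from \<open>u\<close> to
      \<open>v\<close> amounts to representing \<open>inv u \<otimes> v\<close>.\<close>
    obtain i j where ij: "a [^] i \<otimes> b [^] j = inv u \<otimes> v" "i + j \<le> n"
      using cover[of "inv u \<otimes> v"] uv by auto
    have "u \<otimes> (a [^] i \<otimes> b [^] j) = v" using uv by (simp add: ij m_assoc[symmetric])
    then obtain p where p: "C.awalk u p v" "length p = i + j"
      using pow_imp_awalk_cayley[OF ab uv(1), of i j] by auto
    have "C.\<mu> (\<lambda>_. 1) u v \<le> ereal (C.awalk_cost (\<lambda>_. 1) p)"
      by (rule C.min_cost_le_walk_cost[OF p(1)])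
    also have "C.awalk_cost (\<lambda>_. 1) p = real (i + j)"
      using p(2) by (simp add: C.awalk_cost_def sum_list_triv)
    also have "ereal (real (i + j)) \<le> ereal (real n)" using ij(2) by simp
    finally show ?thesis .
  qed
  then show ?thesis unfolding diameter_def
    by (intro SUP_least) (simp_all add: cayley_def)
qed

lemma le_diameter_cayley:
  assumes ab: "a \<in> carrier G" "b \<in> carrier G"
    and min: "\<And>i' j' :: nat. a [^] i' \<otimes> b [^] j' = a [^] i \<otimes> b [^] j \<Longrightarrow> i + j \<le> i' + j'"
  shows "ereal (real (i + j)) \<le> diameter (cayley G {a, b})"
proof -
  interpret C: wf_digraph "cayley G {a, b}"
    by (rule wf_digraph_cayley) (use ab in auto)
  define x where "x = a [^] i \<otimes> b [^] j"
  have x: "x \<in> carrier G" using ab by (simp add: x_def)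
  have "ereal (real (i + j)) \<le> C.\<mu> (\<lambda>_. 1) \<one> x"
    unfolding C.\<mu>_def
  proof (rule INF_greatest)
    fix p assume "p \<in> {p. C.awalk \<one> p x}"
    then obtain i' j' where ij': "length p = i' + j'" "x = \<one> \<otimes> (a [^] i' \<otimes> b [^] j')"
      using awalk_cayley_imp_pow[OF ab, of \<one> p x] by auto
    then have "i + j \<le> length p" using min[of i' j'] ab by (simp add: x_def)
    moreover have "C.awalk_cost (\<lambda>_. 1) p = real (length p)"
      by (simp add: C.awalk_cost_def sum_list_triv)
    ultimately show "ereal (real (i + j)) \<le> ereal (C.awalk_cost (\<lambda>_. 1) p)"
      by simp
  qed
  also have "\<dots> \<le> diameter (cayley G {a, b})"
    unfolding diameter_def
    by (rule SUP_upper2[of \<one>], simp add: cayley_def)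
       (rule SUP_upper, use x in \<open>simp add: cayley_def\<close>)
  finally show ?thesis .
qed

section \<open>The general lower bound for the diameter\<close>

lemma lb_order_le_diameter:
  assumes fin: "finite (carrier G)" and ab: "a \<in> carrier G" "b \<in> carrier G"
    and gen: "generate G {a, b} = carrier G"
  shows "ereal (real_of_int (lb (order G))) \<le> diameter (cayley G {a, b})"
proof -
  define f where "f = (\<lambda>(i :: nat) (j :: nat). a [^] i \<otimes> b [^] j)"
  have fcl: "f i j \<in> carrier G" for i j using ab by (simp add: f_def)
  have cancel: "f (i + k) (j + m) = f (i' + k) (j' + m) \<longleftrightarrow> f i j = f i' j'" for i j i' j' k m
    unfolding f_def by (rule pow_mult_pow_cancel[OF ab])
  \<comment> \<open>Ties in \<open>i + j\<close> are broken by \<open>i\<close>: this order is invariant under shifts, so \<open>S\<close> is down-closed.\<close>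
  define S where "S = {(i, j). \<forall>i' j'. f i' j' = f i j \<longrightarrow> i + j < i' + j' \<or> i + j = i' + j' \<and> i \<le> i'}"
  have SD: "i + j < i' + j' \<or> i + j = i' + j' \<and> i \<le> i'"
    if "(i, j) \<in> S" "f i' j' = f i j" for i j i' j'
    using that by (auto simp: S_def)
  have inj: "inj_on (\<lambda>(i, j). f i j) S"
  proof (rule inj_onI, clarify)
    fix i j i' j' assume "(i, j) \<in> S" "(i', j') \<in> S" "f i j = f i' j'"
    then show "i = i' \<and> j = j'" using SD[of i j i' j'] SD[of i' j' i j] by auto
  qed
  have cover: "\<exists>i' j'. (i', j') \<in> S \<and> f i' j' = f i j" for i j
  proof -
    define Q where "Q = {(i', j'). f i' j' = f i j}"
    have ij: "(i, j) \<in> Q" by (simp add: Q_def)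
    \<comment> \<open>Well-foundedness of the lexicographic order on \<open>(i + j, i)\<close>
      provides a least representation in each class.\<close>
    have wf: "wf (inv_image (less_than <*lex*> less_than) (\<lambda>(i, j). (i + j, i)))"
      by (intro wf_inv_image wf_lex_prod wf_less_than)
    obtain z where "z \<in> Q"
      and "\<And>y. (y, z) \<in> inv_image (less_than <*lex*> less_than) (\<lambda>(i, j). (i + j, i)) \<Longrightarrow> y \<notin> Q"
      using wfE_min[OF wf ij] by blast
    moreover obtain i' j' where "z = (i', j')" by (cases z)
    ultimately have ij': "f i' j' = f i j"
      and min: "\<And>p q. p + q < i' + j' \<or> p + q = i' + j' \<and> p < i' \<Longrightarrow> f p q \<noteq> f i j"
      by (auto simp: Q_def)
    have "(i', j') \<in> S" unfolding S_def
    proof (intro CollectI case_prodI allI impI)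
      fix p q assume "f p q = f i' j'"
      then have "\<not> (p + q < i' + j' \<or> p + q = i' + j' \<and> p < i')"
        using min[of p q] ij' by auto
      then show "i' + j' < p + q \<or> i' + j' = p + q \<and> i' \<le> p" by auto
    qed
    with ij' show ?thesis by blast
  qed
  have shift: "(i, j) \<in> S" if "(i + k, j + m) \<in> S" for i j k m
    unfolding S_def
  proof (intro CollectI case_prodI allI impI)
    fix i' j' assume "f i' j' = f i j"
    then show "i + j < i' + j' \<or> i + j = i' + j' \<and> i \<le> i'"
      using SD[OF that, of "i' + k" "j' + m"] by (auto simp: cancel)
  qed
  have down: "(i', j') \<in> S" if "(i, j) \<in> S" "i' \<le> i" "j' \<le> j" for i j i' j'
    using shift[of i' "i - i'" j' "j - j'"] that by simp
  have img: "(\<lambda>(i, j). f i j) ` S = carrier G"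
  proof
    show "(\<lambda>(i, j). f i j) ` S \<subseteq> carrier G" using fcl by auto
    show "carrier G \<subseteq> (\<lambda>(i, j). f i j) ` S"
    proof
      fix x assume "x \<in> carrier G"
      then have "\<exists>i j. f i j = x"
        using generate_pair[OF fin ab, of x] gen by (simp add: f_def)
      then obtain i j where "f i j = x" by blast
      with cover[of i j] show "x \<in> (\<lambda>(i, j). f i j) ` S" by force
    qed
  qed
  have "finite S" using finite_imageD[OF _ inj] img fin by simp
  then obtain H where H: "is_lshape H" "S = cells H"
    by (rule downset_tile_is_lshape[OF _ inj down cover]) (simp_all add: cancel)
  have "order G = card S"
    using card_image[OF inj] img by (simp add: order_def)
  with H have area: "lshape_area H = order G" by (simp add: card_cells)
  have "S \<noteq> {}" using cover by blast
  then have "Max ((\<lambda>(i, j). i + j) ` S) \<in> (\<lambda>(i, j). i + j) ` S"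
    using \<open>finite S\<close> by (intro Max_in) auto
  \<comment> \<open>A cell with the largest coordinate sum is a least representation, so its element
    is at least that far from the identity.\<close>
  then obtain i j where ij: "(i, j) \<in> S" "i + j = Max ((\<lambda>(i, j). i + j) ` S)" by auto
  have "lb (order G) \<le> int (i + j)"
    using lb_le_lshape_diameter[OF H(1)] Max_cells[OF H(1)] area ij(2) H(2) by simp
  then have "real_of_int (lb (order G)) \<le> real (i + j)"
    by (metis of_int_le_iff of_int_of_nat_eq)
  moreover have "ereal (real (i + j)) \<le> diameter (cayley G {a, b})"
    by (rule le_diameter_cayley[OF ab]) (use SD[OF ij(1)] in \<open>force simp: f_def\<close>)
  ultimately show ?thesis by (metis ereal_less_eq(3) order_trans)
qed

section \<open>Minimum distance diagrams and tightness\<close>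

lemma mdd_ofI:
  assumes fin: "finite (carrier G)" and ab: "a \<in> carrier G" "b \<in> carrier G"
    and ne: "a \<noteq> b" "a \<noteq> \<one>" "b \<noteq> \<one>"
    and H: "is_lshape H" "lshape_area H = order G"
    and inj: "inj_on (\<lambda>(i, j). a [^] i \<otimes> b [^] j) (cells H)"
    and min: "\<And>i j i' j'. (i, j) \<in> cells H \<Longrightarrow> a [^] i' \<otimes> b [^] j' = a [^] i \<otimes> b [^] j
      \<Longrightarrow> i + j \<le> i' + j'"
  shows "mdd_of H G a b"
proof -
  let ?f = "\<lambda>(i :: nat, j :: nat). a [^] i \<otimes> b [^] j"
  \<comment> \<open>Surjectivity comes from counting: distinct cells represent distinct elements,
    and there are as many cells as elements. The inverse bijection serves as the diagram, and
    surjectivity also shows that \<open>a\<close> and \<open>b\<close> generate.\<close>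
  have "?f ` cells H = carrier G"
  proof (rule card_subset_eq[OF fin])
    show "?f ` cells H \<subseteq> carrier G" using ab by auto
    show "card (?f ` cells H) = card (carrier G)"
      using card_image[OF inj] card_cells[OF H(1)] H(2) by (simp add: order_def)
  qed
  then have bij: "bij_betw ?f (cells H) (carrier G)" using inj by (simp add: bij_betw_def)
  define \<psi> where "\<psi> = inv_into (cells H) ?f"
  have img: "\<psi> ` carrier G = cells H"
    using bij_betw_inv_into[OF bij] by (simp add: \<psi>_def bij_betw_def)
  have \<psi>: "?f (\<psi> x) = x" if "x \<in> carrier G" for x
    using bij_betw_inv_into_right[OF bij that] by (simp add: \<psi>_def)
  have "mdd_map G a b \<psi>"
    unfolding mdd_map_def img
  proof (intro conjI ballI allI impI)
    fix x i j assume x: "x \<in> carrier G" "\<psi> x = (i, j)"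
    show eq: "a [^] i \<otimes> b [^] j = x" using \<psi>[OF x(1)] x(2) by simp
    have "(i, j) \<in> cells H" using img x by force
    then show "i + j \<le> i' + j'" if "a [^] i' \<otimes> b [^] j' = x" for i' j'
      using min[of i j i' j'] that eq by simp
  next
    fix i j i' j' assume "(i, j) \<in> cells H" "i' \<le> i" "j' \<le> j"
    then show "(i', j') \<in> cells H" by (cases H) auto
  qed
  moreover have "two_cayley G {a, b}"
  proof -
    have sub: "{a, b} \<subseteq> carrier G" using ab by simp
    have pow: "c [^] n \<in> generate G {a, b}" if "c \<in> {a, b}" for c and n :: nat
      using that by (induction n) (auto intro: generate.intros)
    have "carrier G \<subseteq> generate G {a, b}"
    proof
      fix x assume "x \<in> carrier G"
      then obtain i j :: nat where "x = a [^] i \<otimes> b [^] j"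
        using \<psi>[of x] by (cases "\<psi> x") auto
      then show "x \<in> generate G {a, b}" using pow by (auto intro: generate.eng)
    qed
    then have "generate G {a, b} = carrier G"
      using generate_incl[OF sub] by blast
    then show ?thesis
      using fin ab ne comm_group_axioms by (auto simp: two_cayley_def)
  qed
  ultimately show ?thesis using H(1) img by (auto simp: mdd_of_def)
qed

end

lemma lb_le_diameter:
  assumes "two_cayley G A"
  shows "ereal (real_of_int (lb (order G))) \<le> diameter (cayley G A)"
proof -
  interpret comm_group G using assms by (simp add: two_cayley_def)
  obtain a b where "A = {a, b}" using assms by (auto simp: two_cayley_def card_2_iff)
  with assms show ?thesis
    by (auto simp: two_cayley_def intro: lb_order_le_diameter)
qed

text \<open>The diagram reaches each element within its largest coordinate sum, which tightness
  identifies with \<open>lb\<close>; the general lower bound supplies the other inequality.\<close>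

lemma mdd_of_tight:
  fixes G (structure)
  assumes mdd: "mdd_of H G a b" and "tight_lshape H" "lshape_area H = order G"
  shows "tight_cayley G {a, b}"
proof -
  have tc: "two_cayley G {a, b}" and H: "is_lshape H" using mdd by (auto simp: mdd_of_def)
  interpret comm_group G using tc by (simp add: two_cayley_def)
  obtain \<psi> where \<psi>: "mdd_map G a b \<psi>" "\<psi> ` carrier G = cells H"
    using mdd by (auto simp: mdd_of_def)
  define n where "n = Max ((\<lambda>(i, j). i + j) ` cells H)"
  have n: "int n = lb (order G)"
    using Max_cells[OF H] assms(2,3) by (simp add: n_def tight_lshape_def)
  have ab: "a \<in> carrier G" "b \<in> carrier G" and fin: "finite (carrier G)"
    using tc by (auto simp: two_cayley_def)
  have "diameter (cayley G {a, b}) \<le> ereal (real n)"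
  proof (rule diameter_cayley_le[OF ab])
    fix x assume x: "x \<in> carrier G"
    obtain i j where ij: "\<psi> x = (i, j)" by (cases "\<psi> x")
    have "(i, j) \<in> cells H" using \<psi>(2) x ij by force
    moreover have "finite (cells H)" using \<psi>(2) fin by (metis finite_imageI)
    ultimately have "i + j \<le> n" unfolding n_def by (intro Max_ge) force+
    moreover have "a [^] i \<otimes> b [^] j = x" using \<psi>(1) x ij by (auto simp: mdd_map_def)
    ultimately show "\<exists>i j. a [^] i \<otimes> b [^] j = x \<and> i + j \<le> n" by blast
  qed
  also have "real n = real_of_int (lb (order G))" using n by (metis of_int_of_nat_eq)
  finally show ?thesis
    using lb_le_diameter[OF tc] tc by (simp add: tight_cayley_def antisym)
qed

lemma lb_le_D2: "ereal (real_of_int (lb N)) \<le> D2 N"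
  unfolding D2_def by (rule Inf_greatest) (use lb_le_diameter in blast)

text \<open>The radicand is the perfect square \<open>(3 * t) ^ 2\<close>, so the ceiling is
  exact.\<close>

lemma lb_three_times_square: "lb (3 * t ^ 2) = 3 * int t - 2"
proof -
  have "sqrt (3 * real (3 * t ^ 2)) = sqrt ((real (3 * t))\<^sup>2)"
    by (simp add: power2_eq_square)
  also have "\<dots> = real (3 * t)" by (rule real_sqrt_unique) auto
  finally show ?thesis unfolding lb_def by (metis ceiling_of_nat of_nat_mult of_nat_numeral)
qed

section \<open>The digraphs on \<open>\<int>\<^sub>t \<oplus> \<int>\<^sub>3\<^sub>t\<close>\<close>

lemma nat_pow_DirProd:
  fixes n :: nat
  shows "(x, y) [^]\<^bsub>G \<times>\<times> H\<^esub> n = (x [^]\<^bsub>G\<^esub> n, y [^]\<^bsub>H\<^esub> n)"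
  by (induction n) simp_all

lemma comm_group_DirProd:
  assumes "comm_group G" "comm_group H"
  shows "comm_group (G \<times>\<times> H)"
proof -
  interpret G: comm_group G by fact
  interpret H: comm_group H by fact
  show ?thesis
    by (rule group.group_comm_groupI[OF DirProd_group])
       (auto simp: G.m_comm H.m_comm intro: G.is_group H.is_group)
qed

text \<open>A generator would have order \<open>order G\<close>, yet its order divides
  \<open>n\<close>.\<close>

lemma not_cyclic_if_exponent_less_order:
  fixes G (structure)
  assumes "group G" "0 < n" "n < order G" "\<And>x. x \<in> carrier G \<Longrightarrow> x [^] n = \<one>"
  shows "\<not> cyclic_group G"
proof
  interpret group G by fact
  assume "cyclic_group G"
  then obtain x where x: "x \<in> carrier G" "carrier G = range (\<lambda>n :: int. x [^] n)"
    by (auto simp: cyclic_group)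
  have "generate G {x} = carrier G" using generate_pow[OF x(1)] x(2) by auto
  then have "order G = ord x" using generate_pow_card[OF x(1)] by (simp add: order_def)
  moreover have "ord x dvd n" using assms(4)[OF x(1)] pow_eq_id[OF x(1)] by blast
  ultimately show False using dvd_imp_le[of "ord x" n] \<open>0 < n\<close> \<open>n < order G\<close> by simp
qed

text \<open>With \<open>i\<close> and \<open>j - i\<close> as the two components of an element, this
  describes the relation lattice of the generators: \<open>t\<close> times the pairs congruent
  modulo 3.\<close>

lemma mod_three_times_eqE:
  fixes i j i' j' t :: int
  assumes "i mod t = i' mod t" "(j - i) mod (3 * t) = (j' - i') mod (3 * t)"
  obtains p q where "i' = i + t * p" "j' = j + t * q" "3 dvd q - p"
proof -
  obtain p where p: "i' = i + t * p"
    using assms(1) by (metis mod_eqE mult.commute)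
  obtain r where r: "j' - i' = j - i + 3 * t * r"
    using assms(2) by (metis mod_eqE mult.commute)
  show thesis
    by (rule that[OF p, of "p + 3 * r"]) (use p r in \<open>auto simp: algebra_simps\<close>)
qed

text \<open>Coordinates of a cell are below \<open>2 * t\<close>, so a shift by
  \<open>- 2 * t\<close> or less turns negative. A shift by \<open>- t\<close> in the first
  coordinate starts from \<open>t \<le> i\<close>, where the notch forces \<open>j < t\<close> and
  leaves no room for a downward shift.\<close>

lemma cells_dilate_translate:
  fixes p q :: int
  assumes t: "0 < t" and ij: "(i, j) \<in> cells (L (2 * t) (2 * t) t t)"
    and pq: "int i' = int i + int t * p" "int j' = int j + int t * q"
  shows "-1 \<le> p" "-1 \<le> q" "p = -1 \<Longrightarrow> 0 \<le> q"
proof -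
  have bound: "-1 \<le> r" if "x < 2 * t" "int x' = int x + int t * r" for x x' :: nat and r :: int
  proof (rule ccontr)
    assume "\<not> -1 \<le> r"
    then have "int t * r \<le> int t * (-2)" by (intro mult_left_mono) auto
    with that show False by simp
  qed
  show "-1 \<le> p" "-1 \<le> q" using bound ij pq by auto
  assume "p = -1"
  with pq(1) have "t \<le> i" by simp
  with ij have "j < t" by auto
  show "0 \<le> q"
  proof (rule ccontr)
    assume "\<not> 0 \<le> q"
    then have "int t * q \<le> int t * (-1)" by (intro mult_left_mono) auto
    with pq(2) \<open>j < t\<close> show False by simp
  qed
qed

lemma mdd_of_dilate:
  fixes t :: nat and G (structure)
  assumes t: "t \<ge> 2"
  defines "G \<equiv> integer_mod_group t \<times>\<times> integer_mod_group (3 * t)"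
  shows "mdd_of (L (2 * t) (2 * t) t t) G (1, (- 1) mod (3 * int t)) (0, 1)"
    and "order G = 3 * t ^ 2" and "\<not> cyclic_group G"
proof -
  interpret comm_group G
    unfolding G_def by (intro comm_group_DirProd abelian_integer_mod_group)
  have carrier: "carrier G = {0..<int t} \<times> {0..<3 * int t}"
    using t by (simp add: G_def carrier_integer_mod_group)
  then show order: "order G = 3 * t ^ 2"
    by (simp add: order_def power2_eq_square card_cartesian_product nat_mult_distrib)
  have one: "\<one> = (0, 0)" by (simp add: G_def)
  let ?a = "(1 :: int, (- 1) mod (3 * int t))" and ?b = "(0 :: int, 1 :: int)"
  have f: "?a [^] i \<otimes> ?b [^] j = (int i mod int t, (int j - int i) mod (3 * int t))" for i j :: nat
  proof -
    have "(int i * ((- 1) mod (3 * int t)) + int j) mod (3 * int t) = (int j - int i) mod (3 * int t)"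
      by (metis (no_types) add.commute diff_conv_add_uminus mod_add_right_eq mod_mult_right_eq
          mult_minus1_right)
    then show ?thesis
      by (simp add: G_def nat_pow_DirProd mod_add_left_eq mod_add_right_eq)
  qed
  let ?H = "L (2 * t) (2 * t) t t"
  have repr: "\<exists>p q. int i' = int i + int t * p \<and> int j' = int j + int t * q \<and> 3 dvd q - p"
    if "?a [^] i' \<otimes> ?b [^] j' = ?a [^] i \<otimes> ?b [^] j" for i j i' j'
  proof -
    have "int i mod int t = int i' mod int t"
      "(int j - int i) mod (3 * int t) = (int j' - int i') mod (3 * int t)"
      using that unfolding f by simp_all
    then show ?thesis by (rule mod_three_times_eqE) blast
  qed
  show "mdd_of ?H G ?a ?b"
  proof (rule mdd_ofI)
    show "?a \<in> carrier G" "?b \<in> carrier G" using t by (auto simp: carrier)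
    show "is_lshape ?H" using t by simp
    show "lshape_area ?H = order G" by (simp add: order power2_eq_square)
    show "inj_on (\<lambda>(i, j). ?a [^] i \<otimes> ?b [^] j) (cells ?H)"
    proof (rule inj_onI, clarify)
      fix i j i' j'
      assume c: "(i, j) \<in> cells ?H" "(i', j') \<in> cells ?H"
        and eq: "?a [^] i \<otimes> ?b [^] j = ?a [^] i' \<otimes> ?b [^] j'"
      obtain p q where pq: "int i' = int i + int t * p" "int j' = int j + int t * q" "3 dvd q - p"
        using repr[OF eq[symmetric]] by blast
      have t0: "0 < t" using t by simp
      have pq': "int i = int i' + int t * (- p)" "int j = int j' + int t * (- q)"
        using pq by auto
      \<comment> \<open>Applying the bounds to the shift and to its inverse leaves \<open>p\<close>
        and \<open>q\<close> in {-1, 0, 1}. Congruence modulo 3 makes them equal, and a joint -1 is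
        excluded in either direction.\<close>
      have "p = 0 \<and> q = 0"
        using cells_dilate_translate[OF t0 c(1) pq(1,2)] cells_dilate_translate[OF t0 c(2) pq'] pq(3)
        by presburger
      with pq(1,2) show "i = i' \<and> j = j'" by simp
    qed
    show "i + j \<le> i' + j'"
      if ij: "(i, j) \<in> cells ?H" and eq: "?a [^] i' \<otimes> ?b [^] j' = ?a [^] i \<otimes> ?b [^] j"
      for i j i' j'
    proof -
      obtain p q where pq: "int i' = int i + int t * p" "int j' = int j + int t * q" "3 dvd q - p"
        using repr[OF eq] by blast
      have t0: "0 < t" using t by simp
      \<comment> \<open>The bounds leave (-1, 0) and (0, -1) as the only pairs of negative sum, and
        neither is congruent modulo 3.\<close>
      have "0 \<le> p + q"
        using cells_dilate_translate[OF t0 ij pq(1,2)] pq(3) by presburger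
      then have "0 \<le> int t * (p + q)" by simp
      then have "int (i + j) \<le> int (i' + j')" using pq(1,2) by (simp add: distrib_left)
      then show ?thesis by simp
    qed
  qed (use t in \<open>auto simp: carrier one\<close>)
  show "\<not> cyclic_group G"
  \<comment> \<open>The exponent \<open>3 * t\<close> kills both components and is below
    \<open>3 * t ^ 2\<close> because \<open>t\<close> is at least 2.\<close>
  proof (rule not_cyclic_if_exponent_less_order[where n = "3 * t"])
    show "3 * t < order G" using t by (simp add: order power2_eq_square)
    show "x [^] (3 * t) = \<one>" for x
      by (cases x) (simp add: G_def nat_pow_DirProd)
  qed (use t in auto)
qed

lemma mdd_of_Z3: "mdd_of (L 2 2 1 1) (integer_mod_group 3) 2 1"
proof -
  interpret comm_group "integer_mod_group 3" by simp
  have carrier: "carrier (integer_mod_group 3) = {0..<3}" by (simp add: carrier_integer_mod_group)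
  have f: "2 [^]\<^bsub>integer_mod_group 3\<^esub> i \<otimes>\<^bsub>integer_mod_group 3\<^esub> 1 [^]\<^bsub>integer_mod_group 3\<^esub> j
      = (2 * int i + int j) mod 3" for i j :: nat
    by (simp add: mod_add_left_eq mod_add_right_eq mult.commute)
  have cells: "cells (L 2 2 1 1) = {(0, 0), (0, 1), (1, 0)}" by auto
  show ?thesis
  proof (rule mdd_ofI)
    show "inj_on (\<lambda>(i, j). 2 [^]\<^bsub>integer_mod_group 3\<^esub> i
        \<otimes>\<^bsub>integer_mod_group 3\<^esub> 1 [^]\<^bsub>integer_mod_group 3\<^esub> j) (cells (L 2 2 1 1))"
      unfolding f cells by (auto simp: inj_on_def)
    show "i + j \<le> i' + j'"
      if "(i, j) \<in> cells (L 2 2 1 1)"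
        "2 [^]\<^bsub>integer_mod_group 3\<^esub> i' \<otimes>\<^bsub>integer_mod_group 3\<^esub> 1 [^]\<^bsub>integer_mod_group 3\<^esub> j'
          = 2 [^]\<^bsub>integer_mod_group 3\<^esub> i \<otimes>\<^bsub>integer_mod_group 3\<^esub> 1 [^]\<^bsub>integer_mod_group 3\<^esub> j"
      for i j i' j'
      \<comment> \<open>Every cell has sum at most 1, so only the competitor with
        \<open>i' + j' = 0\<close> could be shorter, and it represents 0.\<close>
      using that unfolding f cells by (cases "i' + j' = 0") auto
  qed (auto simp: carrier order_def)
qed

theorem theorem4:
  shows "(tight_cayley (integer_mod_group 3) {2, 1} \<and> mdd_of (L 2 2 1 1) (integer_mod_group 3) 2 1) \<and>
    (\<forall>t::nat. t \<ge> 2 \<longrightarrow>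
      (let H = dilate t (L 2 2 1 1);
           N = 3 * t ^ 2;
           G = integer_mod_group t \<times>\<times> integer_mod_group (3 * t);
           a = (1, (- 1) mod (3 * int t));
           b = (0, 1)
       in (H = L (2 * t) (2 * t) t t \<and> is_mdd H \<and> tight_lshape H \<and> lshape_area H = N) \<and>
          mdd_of H G a b \<and>
          (diameter (cayley G {a, b}) = D2 N \<and> D2 N = ereal (real_of_int (lb N)) \<and>
           lb N = 3 * int t - 2)))"
proof (intro conjI allI impI)
  \<comment> \<open>The square formula at 1 gives \<open>lb 3 = 1\<close>, which is the diameter of
    the L-shape.\<close>
  have "tight_lshape (L 2 2 1 1)" "lshape_area (L 2 2 1 1) = order (integer_mod_group 3)"
    using lb_three_times_square[of 1]
    by (simp_all add: tight_lshape_def order_def carrier_integer_mod_group)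
  with mdd_of_Z3 show "tight_cayley (integer_mod_group 3) {2, 1}" by (rule mdd_of_tight)
next
  fix t :: nat assume t: "2 \<le> t"
  define G where "G = integer_mod_group t \<times>\<times> integer_mod_group (3 * t)"
  define H where "H = L (2 * t) (2 * t) t t"
  define A where "A = {(1 :: int, (- 1) mod (3 * int t)), (0, 1)}"
  note mdd = mdd_of_dilate[OF t, folded G_def H_def]
  have dil: "dilate t (L 2 2 1 1) = H" by (simp add: H_def mult.commute)
  have area: "lshape_area H = 3 * t ^ 2" by (simp add: H_def power2_eq_square)
  have tight: "tight_lshape H"
    using t area by (simp add: tight_lshape_def lb_three_times_square) (simp add: H_def)
  have tc: "tight_cayley G A"
    unfolding A_def by (rule mdd_of_tight[OF mdd(1) tight]) (simp add: area mdd(2))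
  then have diam: "diameter (cayley G A) = ereal (real_of_int (lb (3 * t ^ 2)))"
    by (simp add: tight_cayley_def mdd(2))
  \<comment> \<open>Being non-cyclic, \<open>G\<close> competes in \<open>D2\<close> up to
    isomorphism; its diameter already equals the lower bound, so the minimum is attained
    there.\<close>
  have "D2 (3 * t ^ 2) \<le> diameter (cayley G A)"
    by (rule D2_le) (use tc mdd in \<open>simp_all add: tight_cayley_def\<close>)
  then have D2: "D2 (3 * t ^ 2) = ereal (real_of_int (lb (3 * t ^ 2)))"
    using diam lb_le_D2 by (simp add: antisym)
  show "let H = dilate t (L 2 2 1 1); N = 3 * t ^ 2;
      G = integer_mod_group t \<times>\<times> integer_mod_group (3 * t);
      a = (1, (- 1) mod (3 * int t)); b = (0, 1)
    in (H = L (2 * t) (2 * t) t t \<and> is_mdd H \<and> tight_lshape H \<and> lshape_area H = N) \<and>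
       mdd_of H G a b \<and>
       (diameter (cayley G {a, b}) = D2 N \<and> D2 N = ereal (real_of_int (lb N)) \<and>
        lb N = 3 * int t - 2)"
    unfolding Let_def dil G_def[symmetric] A_def[symmetric] D2 diam area
    using is_mddI[OF mdd(1)] mdd(1) tight lb_three_times_square by (simp add: H_def)
qed (rule mdd_of_Z3)

end
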